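(* Let $G$ be a graph with $n$ vertices, and let $b,a,m,\Delta$ be non-negative integers with $b-\Delta\ge a\ge 2$, $\delta(G)\ge\frac{(\Delta+a)n}{b+2a+\Delta}+\frac{b(b-\Delta)}{\Delta+a}+m$ and $n>\frac{(b+a+2m-1)(b+2a+\Delta)}{\Delta+a}$. Let $g,f$ be integer-valued functions on $V(G)$ with $b-\Delta\ge f(x)-\Delta\ge g(x)\ge a$ for every vertex $x$. If for every pair of distinct non-adjacent vertices $x,y$ (i.e. $xy\notin E(G)$) we have $\max\{d_G(y),d_G(x)\}\ge\frac{(b+a)n}{b+2a+\Delta}$, then $G$ is fractional ID-$(g,f,m)$-deleted.
   Context: All graphs are finite and simple; $\delta(G)$ is the minimum degree and $d_G(x)$ the degree of $x$. For integer-valued functions $g\le f$ on $V(G)$, a fractional $(g,f)$-factor of $G$ is a function $h:E(G)\to[0,1]$ such that $g(x)\le\sum_{e\ni x}h(e)\le f(x)$ for every vertex $x$. $G$ is fractional $(g,f,m)$-deleted if for every $H\subseteq E(G)$ with $|H|=m$, $G-H$ has a fractional $(g,f)$-factor. $G$ is fractional ID-$(g,f,m)$-deleted if for every independent set $I\subseteq V(G)$, $G-I$ is fractional $(g,f,m)$-deleted (with $g,f$ restricted to $V(G)\setminus I$). *)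

theory Defs
  imports Complex_Main
begin

definition simple_graph :: "'a set \<Rightarrow> 'a set set \<Rightarrow> bool" where
  "simple_graph V E \<longleftrightarrow> finite V \<and> (\<forall>e\<in>E. e \<subseteq> V \<and> card e = 2)"

definition incident_edges :: "'a set set \<Rightarrow> 'a \<Rightarrow> 'a set set" where
  "incident_edges E x = {e \<in> E. x \<in> e}"

definition degree :: "'a set set \<Rightarrow> 'a \<Rightarrow> nat" where
  "degree E x = card (incident_edges E x)"

(* Only meaningful for nonempty V. *)
definition min_degree :: "'a set \<Rightarrow> 'a set set \<Rightarrow> nat" where
  "min_degree V E = Min (degree E ` V)"

definition independent_set :: "'a set \<Rightarrow> 'a set set \<Rightarrow> 'a set \<Rightarrow> bool" where
  "independent_set V E I \<longleftrightarrow> I \<subseteq> V \<and> (\<forall>x\<in>I. \<forall>y\<in>I. {x, y} \<notin> E)"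

definition fractional_factor ::
  "'a set \<Rightarrow> 'a set set \<Rightarrow> ('a \<Rightarrow> int) \<Rightarrow> ('a \<Rightarrow> int) \<Rightarrow> ('a set \<Rightarrow> real) \<Rightarrow> bool" where
  "fractional_factor V E g f h \<longleftrightarrow>
     (\<forall>e\<in>E. 0 \<le> h e \<and> h e \<le> 1) \<and>
     (\<forall>x\<in>V. real_of_int (g x) \<le> (\<Sum>e\<in>incident_edges E x. h e) \<and>
             (\<Sum>e\<in>incident_edges E x. h e) \<le> real_of_int (f x))"

definition fractional_deleted ::
  "'a set \<Rightarrow> 'a set set \<Rightarrow> ('a \<Rightarrow> int) \<Rightarrow> ('a \<Rightarrow> int) \<Rightarrow> nat \<Rightarrow> bool" where
  "fractional_deleted V E g f m \<longleftrightarrow>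
     (\<forall>H. H \<subseteq> E \<and> card H = m \<longrightarrow> (\<exists>h. fractional_factor V (E - H) g f h))"

(* The edges of G - I are the edges of G that avoid I. *)
definition fractional_ID_deleted ::
  "'a set \<Rightarrow> 'a set set \<Rightarrow> ('a \<Rightarrow> int) \<Rightarrow> ('a \<Rightarrow> int) \<Rightarrow> nat \<Rightarrow> bool" where
  "fractional_ID_deleted V E g f m \<longleftrightarrow>
     (\<forall>I. independent_set V E I \<longrightarrow>
        fractional_deleted (V - I) {e \<in> E. e \<inter> I = {}} g f m)"

end

theory Submission
  imports "HOL-Analysis.Function_Topology" Defs
begin

text \<open>
  If no fractional factor exists, there are disjoint sets \<open>S\<close>, \<open>T\<close> of vertices of \<open>G - I - H\<close> with
  \<open>f(S) + d(T) < g(T)\<close>, where \<open>d\<close> is the degree after removing \<open>S\<close>. As \<open>f \<ge> c = a + \<Delta>\<close> and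
  \<open>g \<le> \<beta> = b - \<Delta>\<close>, this gives \<open>c |S| + \<Sum>\<^sub>T d - \<beta> |T| < 0\<close>, and passing from \<open>G - I - H\<close> to
  \<open>G - I\<close> costs at most \<open>2m\<close>. With \<open>N = n / (b + 2a + \<Delta>)\<close>, the degree condition on non-adjacent pairs
  bounds \<open>|I|\<close> by \<open>c N\<close>, and the minimum degree then forces \<open>|T| > b\<close>. Hence a vertex
  \<open>x\<^sub>1 \<in> T\<close> of least degree \<open>d\<^sub>1\<close> in \<open>G - I - S\<close> has non-neighbours in \<open>T\<close>; let \<open>d\<^sub>2\<close> be their least
  degree. One of the two vertices has degree at least \<open>(a + b) N\<close> in \<open>G\<close>, so
  \<open>|S| \<ge> (a + b) N - |I| - d\<^sub>2\<close>. At most \<open>d\<^sub>1 + 1\<close> vertices of \<open>T\<close> have degree below \<open>d\<^sub>2\<close>,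
  and \<open>|T| \<le> n - |I| - |S|\<close>; these bounds contradict the cut inequality in each of the cases
  \<open>d\<^sub>2 = 0\<close>, \<open>1 \<le> d\<^sub>2 \<le> \<beta>\<close> and \<open>d\<^sub>2 \<ge> \<beta>\<close>.
\<close>

section \<open>Fractional factors and violated cuts\<close>

lemma sum_degree_swap:
  fixes h :: "'a set \<Rightarrow> 'b::comm_semiring_1"
  assumes "finite T" "finite F"
  shows "(\<Sum>x\<in>T. \<Sum>e\<in>incident_edges F x. h e) = (\<Sum>e\<in>F. of_nat (card (e \<inter> T)) * h e)"
proof -
  have "{x. x \<in> T \<and> x \<in> e} = e \<inter> T" for e by blast
  then show ?thesis
    using sum.swap_restrict[OF assms, of "\<lambda>_. h" "(\<in>)"]
    by (simp add: incident_edges_def)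
qed

lemma finite_edges:
  assumes "simple_graph V E"
  shows "finite E"
  using assms unfolding simple_graph_def
  by (meson Pow_iff finite_Pow_iff finite_subset subsetI)

text \<open>Tychonoff's theorem makes the cube of all weights compact, so a continuous objective
  attains its minimum. The weights are total functions, so the cube is indexed by all sets, not just
  by the members of \<open>F\<close>.\<close>

lemma exists_minimizing_weight:
  fixes \<phi> :: "'a \<Rightarrow> real \<Rightarrow> real" and F :: "'a set set"
  assumes cont: "\<And>x. continuous_on UNIV (\<phi> x)"
  obtains h :: "'a set \<Rightarrow> real" where "\<And>e. h e \<in> {0..1}"
    and "\<And>h'. (\<And>e. h' e \<in> {0..1}) \<Longrightarrow>
      (\<Sum>x\<in>V. \<phi> x (sum h (incident_edges F x))) \<le> (\<Sum>x\<in>V. \<phi> x (sum h' (incident_edges F x)))"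
proof -
  define K :: "('a set \<Rightarrow> real) set" where "K = PiE UNIV (\<lambda>_. {0..1})"
  define \<Phi> where "\<Phi> h = (\<Sum>x\<in>V. \<phi> x (sum h (incident_edges F x)))" for h
  have "compactin (product_topology (\<lambda>_. euclidean) UNIV) K"
    unfolding K_def by (subst compactin_PiE) auto
  then have "compact K" by (simp add: euclidean_product_topology)
  moreover have "(\<lambda>_. 0) \<in> K" by (auto simp: K_def)
  moreover have "continuous_on K \<Phi>"
    unfolding \<Phi>_def
    by (intro continuous_intros continuous_on_compose2[OF cont]
        continuous_on_subset[OF continuous_on_product_coordinates]) auto
  ultimately obtain h where "h \<in> K" "\<And>h'. h' \<in> K \<Longrightarrow> \<Phi> h \<le> \<Phi> h'"
    using continuous_attains_inf[of K \<Phi>] by blast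
  then show ?thesis
    by (intro that[of h]) (auto simp: K_def \<Phi>_def PiE_UNIV_domain Pi_iff)
qed

text \<open>Minimise the sum of the squared distances of the vertex sums from the intervals
  \<open>[g x, f x]\<close>, and let \<open>y x\<close> be the signed distance. Varying \<open>h\<close> on a single edge \<open>uv\<close> shows that
  \<open>h\<close> is 1 there if \<open>y u + y v > 0\<close> and 0 if \<open>y u + y v < 0\<close>, so the sets where \<open>y\<close> is negative and
  positive violate the cut condition.\<close>
lemma fractional_factor_obstruction:
  fixes g f :: "'a \<Rightarrow> int"
  assumes graph: "simple_graph V F" and gf: "\<And>x. x \<in> V \<Longrightarrow> g x \<le> f x"
    and no_factor: "\<nexists>h. fractional_factor V F g f h"
  obtains S T where "S \<subseteq> V" "T \<subseteq> V" "S \<inter> T = {}"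
    "sum f S + (\<Sum>x\<in>T. int (degree {e\<in>F. e \<inter> S = {}} x)) < sum g T"
    "\<And>x. x \<in> T \<Longrightarrow> int (degree {e\<in>F. e \<inter> S = {}} x) < g x"
proof -
  have finV: "finite V" and edge: "\<And>e. e \<in> F \<Longrightarrow> e \<subseteq> V \<and> card e = 2"
    using graph by (auto simp: simple_graph_def)
  have finF: "finite F" by (rule finite_edges[OF graph])
  define \<phi> where "\<phi> x t = (max (real_of_int (g x)) (min (real_of_int (f x)) t) - t)\<^sup>2" for x t
  have "continuous_on UNIV (\<phi> x)" for x
    unfolding \<phi>_def by (intro continuous_intros)
  then obtain h :: "'a set \<Rightarrow> real" where h01: "\<And>e. h e \<in> {0..1}"
    and hmin: "\<And>h'. (\<And>e. h' e \<in> {0..1}) \<Longrightarrow>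
      (\<Sum>x\<in>V. \<phi> x (sum h (incident_edges F x))) \<le> (\<Sum>x\<in>V. \<phi> x (sum h' (incident_edges F x)))"
    using exists_minimizing_weight[of \<phi> F V] by blast
  define s where "s x = sum h (incident_edges F x)" for x
  define y where "y x = max (g x) (min (f x) (s x)) - s x" for x
  have variation: "\<epsilon> * sum y e \<le> \<epsilon>\<^sup>2" if e: "e \<in> F" and \<epsilon>: "h e + \<epsilon> \<in> {0..1}" for e \<epsilon>
  proof -
    define h' where "h' = h(e := h e + \<epsilon>)"
    define s' where "s' x = sum h' (incident_edges F x)" for x
    have s': "s' x = s x + (if x \<in> e then \<epsilon> else 0)" for x
    proof -
      have "s' x = (\<Sum>e'\<in>incident_edges F x. h e' + (if e' = e then \<epsilon> else 0))"
        unfolding s'_def h'_def by (rule sum.cong) auto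
      then show ?thesis
        using finF e by (simp add: sum.distrib s_def incident_edges_def sum.delta')
    qed
    have bound: "\<phi> x (s' x)
        \<le> (y x)\<^sup>2 + (if x \<in> e then \<epsilon>\<^sup>2 - 2 * \<epsilon> * y x else 0)" if "x \<in> V" for x
    proof -
      \<comment> \<open>The clamp of \<open>s x\<close> is a point of \<open>[g x, f x]\<close>, so
        it is at least as far from \<open>s' x\<close> as the nearest point, which is the clamp of
        \<open>s' x\<close>.\<close>
      have "\<bar>max (g x) (min (f x) (s' x)) - s' x\<bar> \<le> \<bar>max (g x) (min (f x) (s x)) - s' x\<bar>"
        using gf[OF that] by (auto simp: max_def min_def abs_if)
      then have "(max (g x) (min (f x) (s' x)) - s' x)\<^sup>2 \<le> (max (g x) (min (f x) (s x)) - s' x)\<^sup>2"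
        by (simp add: abs_le_square_iff)
      also have "\<dots> = (y x)\<^sup>2 + (if x \<in> e then \<epsilon>\<^sup>2 - 2 * \<epsilon> * y x else 0)"
        by (simp add: s' y_def power2_eq_square algebra_simps)
      finally show ?thesis by (simp add: \<phi>_def)
    qed
    have "h' e' \<in> {0..1}" for e' using h01[of e'] \<epsilon> by (simp add: h'_def)
    then have "(\<Sum>x\<in>V. (y x)\<^sup>2) \<le> (\<Sum>x\<in>V. \<phi> x (s' x))"
      using hmin[of h'] by (simp add: y_def s_def s'_def \<phi>_def)
    also have "\<dots> \<le> (\<Sum>x\<in>V. (y x)\<^sup>2 + (if x \<in> e then \<epsilon>\<^sup>2 - 2 * \<epsilon> * y x else 0))"
      by (intro sum_mono bound)
    \<comment> \<open>As \<open>e\<close> has two ends, the added sum is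
      \<open>2 * \<epsilon>\<^sup>2 - 2 * \<epsilon> * sum y e\<close>.\<close>
    also have "\<dots> = (\<Sum>x\<in>V. (y x)\<^sup>2) + (\<Sum>x\<in>e. \<epsilon>\<^sup>2 - 2 * \<epsilon> * y x)"
      using edge[OF e] finV by (simp add: sum.distrib sum.inter_restrict[symmetric] Int_absorb1)
    finally show ?thesis
      using edge[OF e] by (simp add: sum_subtractf sum_distrib_left[symmetric])
  qed
  have h_one: "h e = 1" if "e \<in> F" "sum y e > 0" for e
  proof (rule ccontr)
    assume "h e \<noteq> 1"
    \<comment> \<open>The first bound keeps the new weight at most 1. The second, half of
      \<open>sum y e\<close>, makes the quadratic term smaller than the linear gain.\<close>
    define \<epsilon> where "\<epsilon> = min (1 - h e) (sum y e / 2)"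
    have "0 < \<epsilon>" "\<epsilon> < sum y e" "h e + \<epsilon> \<in> {0..1}"
      using \<open>h e \<noteq> 1\<close> h01[of e] that(2) by (auto simp: \<epsilon>_def min_def)
    with variation[OF that(1), of \<epsilon>] show False by (simp add: power2_eq_square)
  qed
  have h_zero: "h e = 0" if "e \<in> F" "sum y e < 0" for e
  proof (rule ccontr)
    assume "h e \<noteq> 0"
    define \<epsilon> where "\<epsilon> = min (h e) (- sum y e / 2)"
    have "0 < \<epsilon>" "\<epsilon> < - sum y e" "h e - \<epsilon> \<in> {0..1}"
      using \<open>h e \<noteq> 0\<close> h01[of e] that(2) by (auto simp: \<epsilon>_def min_def)
    moreover from this have "\<epsilon> * \<epsilon> < \<epsilon> * (- sum y e)" by (intro mult_strict_left_mono)
    ultimately show False using variation[OF that(1), of "- \<epsilon>"] by (simp add: power2_eq_square)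
  qed
  define S where "S = {x \<in> V. y x < 0}"
  define T where "T = {x \<in> V. y x > 0}"
  have fin: "finite S" "finite T" using finV by (auto simp: S_def T_def)
  have sT: "s x < g x" if "x \<in> T" for x
    using that gf[of x] by (auto simp: T_def y_def max_def min_def split: if_splits)
  have sS: "f x < s x" if "x \<in> S" for x
    using that gf[of x] by (auto simp: S_def y_def max_def min_def split: if_splits)
  define F0 where "F0 = {e \<in> F. e \<inter> S = {}}"
  have one: "h e = 1" if "e \<in> F0" "x \<in> e" "x \<in> T" for e x
  proof (rule h_one)
    show "e \<in> F" using that by (simp add: F0_def)
    have "y z \<ge> 0" if "z \<in> e" for z
      using that \<open>e \<in> F0\<close> edge[of e] by (force simp: F0_def S_def)
    moreover have "finite e" using edge[OF \<open>e \<in> F\<close>] finV finite_subset by blast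
    ultimately show "sum y e > 0"
      using that by (intro sum_pos2[of e x]) (auto simp: T_def)
  qed
  have zero: "h e = 0" if "e \<in> F" "e \<inter> T = {}" "x \<in> e" "x \<in> S" for e x
  proof (rule h_zero[OF that(1)])
    have "- y z \<ge> 0" if "z \<in> e" for z
      using that \<open>e \<inter> T = {}\<close> edge[OF \<open>e \<in> F\<close>] by (force simp: T_def)
    moreover have "finite e" using edge[OF \<open>e \<in> F\<close>] finV finite_subset by blast
    ultimately have "(\<Sum>z\<in>e. - y z) > 0"
      using that by (intro sum_pos2[of e x]) (auto simp: S_def)
    then show "sum y e < 0" by (simp add: sum_negf)
  qed
  have deg_sum: "(\<Sum>e\<in>incident_edges F0 x. h e) = degree F0 x" if "x \<in> T" for x
    using one[OF _ _ that] by (simp add: degree_def incident_edges_def)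
  have deg_le: "real (degree F0 x) \<le> s x" if "x \<in> T" for x
  proof -
    have "sum h (incident_edges F0 x) \<le> sum h (incident_edges F x)"
      using finF h01 by (intro sum_mono2) (auto simp: incident_edges_def F0_def)
    then show ?thesis using deg_sum[OF that] by (simp add: s_def)
  qed
  \<comment> \<open>Double counting: edges avoiding \<open>S\<close> have weight 1 at each end in
    \<open>T\<close>. An edge meeting \<open>S\<close> either has weight 0 or joins \<open>S\<close>
    to \<open>T\<close>, and then contributes the same weight to both sides.\<close>
  have "(\<Sum>x\<in>T. s x) = (\<Sum>e\<in>F. of_nat (card (e \<inter> T)) * h e)"
    unfolding s_def by (rule sum_degree_swap[OF fin(2) finF])
  also have "\<dots> = (\<Sum>e\<in>F0. of_nat (card (e \<inter> T)) * h e) + (\<Sum>e\<in>F - F0. of_nat (card (e \<inter> T)) * h e)"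
    using finF by (subst sum.subset_diff[of F0 F]) (auto simp: F0_def)
  also have "(\<Sum>e\<in>F0. of_nat (card (e \<inter> T)) * h e) = (\<Sum>x\<in>T. real (degree F0 x))"
    using sum_degree_swap[of T F0 h] finF fin(2) deg_sum by (simp add: F0_def)
  also have "(\<Sum>e\<in>F - F0. of_nat (card (e \<inter> T)) * h e) = (\<Sum>e\<in>F - F0. of_nat (card (e \<inter> S)) * h e)"
  proof (rule sum.cong[OF refl])
    fix e assume e: "e \<in> F - F0"
    then obtain u where u: "u \<in> e" "u \<in> S" by (auto simp: F0_def)
    show "of_nat (card (e \<inter> T)) * h e = of_nat (card (e \<inter> S)) * h e"
    proof (cases "e \<inter> T = {}")
      case True
      then show ?thesis using zero[of e u] e u by simp
    next
      case False
      then obtain v where v: "v \<in> e" "v \<in> T" by blast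
      have "u \<noteq> v" using u v by (auto simp: S_def T_def)
      then have "e = {u, v}"
        using edge[of e] e u v by (auto simp: card_2_iff)
      moreover have "u \<notin> T" "v \<notin> S" using u v by (auto simp: S_def T_def)
      ultimately show ?thesis using u v by simp
    qed
  qed
  also have "\<dots> = (\<Sum>e\<in>F. of_nat (card (e \<inter> S)) * h e)"
    using finF by (intro sum.mono_neutral_left) (auto simp: F0_def)
  also have "\<dots> = (\<Sum>x\<in>S. s x)"
    unfolding s_def by (rule sum_degree_swap[OF fin(1) finF, symmetric])
  finally have balance: "(\<Sum>x\<in>T. s x) = (\<Sum>x\<in>T. real (degree F0 x)) + (\<Sum>x\<in>S. s x)" .
  have "\<exists>x\<in>V. y x \<noteq> 0"
  proof (rule ccontr)
    assume "\<not> ?thesis"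
    then have "fractional_factor V F g f h"
      using h01 gf unfolding fractional_factor_def y_def s_def
      by (force simp: max_def min_def split: if_splits)
    with no_factor show False by blast
  qed
  then have "S \<noteq> {} \<or> T \<noteq> {}" by (force simp: S_def T_def)
  have leS: "(\<Sum>x\<in>S. real_of_int (f x)) \<le> (\<Sum>x\<in>S. s x)" and leT: "(\<Sum>x\<in>T. s x) \<le> (\<Sum>x\<in>T. real_of_int (g x))"
    by (intro sum_mono less_imp_le sS sT; assumption)+
  have "(\<Sum>x\<in>S. real_of_int (f x)) < (\<Sum>x\<in>S. s x) \<or> (\<Sum>x\<in>T. s x) < (\<Sum>x\<in>T. real_of_int (g x))"
    using \<open>S \<noteq> {} \<or> T \<noteq> {}\<close> sS sT fin by (meson sum_strict_mono)
  then have "(\<Sum>x\<in>S. real_of_int (f x)) + (\<Sum>x\<in>T. real (degree F0 x)) < (\<Sum>x\<in>T. real_of_int (g x))"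
    using leS leT balance by linarith
  then have "real_of_int (sum f S + (\<Sum>x\<in>T. int (degree F0 x))) < real_of_int (sum g T)"
    by simp
  then have *: "sum f S + (\<Sum>x\<in>T. int (degree F0 x)) < sum g T"
    by (simp only: of_int_less_iff)
  have "int (degree F0 x) < g x" if "x \<in> T" for x
    using deg_le[OF that] sT[OF that] by linarith
  moreover have "S \<subseteq> V" "T \<subseteq> V" "S \<inter> T = {}" by (auto simp: S_def T_def)
  ultimately show ?thesis
    using that[of S T] * unfolding F0_def by blast
qed

section \<open>Numerical contradictions for the three ranges of \<open>d\<^sub>2\<close>\<close>

text \<open>In the next three lemmas \<open>A\<close>, \<open>\<sigma>\<close>, \<open>\<tau>\<close> and \<open>i\<close> stand for \<open>a + b\<close>, \<open>|S|\<close>, \<open>|T|\<close> and \<open>|I|\<close>.\<close>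

lemma no_cut_small_degree:
  fixes A N c \<beta> \<sigma> \<tau> i m d\<^sub>1 d\<^sub>2 :: real
  assumes A: "A = c + \<beta>" and d1: "0 \<le> d\<^sub>1" and d2: "1 \<le> d\<^sub>2" "d\<^sub>2 \<le> \<beta>"
    and m: "0 \<le> m" and c: "0 < c" and i: "i \<le> c * N" and N: "A + 2 * m - 1 < c * N"
    and \<sigma>: "A * N - i - d\<^sub>2 \<le> \<sigma>" and \<tau>: "\<tau> \<le> (A + c) * N - \<sigma> - i"
    and cut: "c * \<sigma> - (\<beta> - d\<^sub>2) * \<tau> - (d\<^sub>2 - d\<^sub>1) * (d\<^sub>1 + 1) \<le> 2 * m - 1"
  shows False
proof -
  have "(\<beta> - d\<^sub>2) * \<tau> \<le> (\<beta> - d\<^sub>2) * ((A + c) * N - \<sigma> - i)"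
    using \<tau> d2 by (intro mult_left_mono) auto
  moreover have "(A - d\<^sub>2) * (A * N - i - d\<^sub>2) \<le> (A - d\<^sub>2) * \<sigma>"
    using \<sigma> d2 A c by (intro mult_left_mono) auto
  moreover have "c * i \<le> c * (c * N)"
    using i c by (intro mult_left_mono) auto
  moreover have "d\<^sub>2 * (A + 2 * m - 1) < d\<^sub>2 * (c * N)"
    using N d2 by (intro mult_strict_left_mono) auto
  moreover have "0 \<le> m * (d\<^sub>2 - 1)" using m d2 by simp
  \<comment> \<open>The facts above leave \<open>2 * m * (d\<^sub>2 - 1) + d\<^sub>2\<^sup>2 -
    d\<^sub>2 + 1 < (d\<^sub>2 - d\<^sub>1) * (d\<^sub>1 + 1)\<close>. The right side is at most
    \<open>(d\<^sub>2 + 1)\<^sup>2 / 4\<close> by the first square, hence at most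
    \<open>d\<^sub>2\<^sup>2 - d\<^sub>2 + 1\<close> by the second.\<close>
  moreover have "0 \<le> (d\<^sub>2 - 1 - 2 * d\<^sub>1)\<^sup>2" "0 \<le> (d\<^sub>2 - 1)\<^sup>2" by simp_all
  ultimately show False
    using cut unfolding A by (simp add: algebra_simps power2_eq_square)
qed

lemma no_cut_zero_degree:
  fixes A N c \<beta> \<sigma> \<tau> i :: real
  assumes A: "A = c + \<beta>" and \<beta>: "0 \<le> \<beta>" and c: "0 < c" and i: "i \<le> c * N"
    and \<sigma>: "A * N - i \<le> \<sigma>" and \<tau>: "\<tau> \<le> (A + c) * N - \<sigma> - i"
    and cut: "c * \<sigma> - \<beta> * \<tau> < 0"
  shows False
proof -
  have "\<beta> * \<tau> \<le> \<beta> * ((A + c) * N - \<sigma> - i)"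
    using \<tau> \<beta> by (intro mult_left_mono) auto
  moreover have "A * (A * N - i) \<le> A * \<sigma>"
    using \<sigma> A c \<beta> by (intro mult_left_mono) auto
  moreover have "c * i \<le> c * (c * N)"
    using i c by (intro mult_left_mono) auto
  ultimately show False
    using cut unfolding A by (simp add: algebra_simps)
qed

lemma no_cut_large_degree:
  fixes b c \<beta> \<sigma> \<tau> m d\<^sub>1 d\<^sub>2 :: real
  assumes "c \<le> b" "\<beta> \<le> b" and d1: "0 \<le> d\<^sub>1" "d\<^sub>1 + 1 \<le> \<beta>" and d2: "\<beta> \<le> d\<^sub>2" and \<tau>: "b < \<tau>"
    and \<sigma>: "b * \<beta> + 2 * m - c * d\<^sub>1 \<le> c * \<sigma>"
    and cut: "c * \<sigma> - (\<beta> - d\<^sub>2) * \<tau> - (d\<^sub>2 - d\<^sub>1) * (d\<^sub>1 + 1) \<le> 2 * m - 1"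
  shows False
proof -
  have "(d\<^sub>2 - \<beta>) * (d\<^sub>1 + 1) \<le> (d\<^sub>2 - \<beta>) * \<tau>"
    using assms by (intro mult_left_mono) auto
  moreover have "c * d\<^sub>1 \<le> b * d\<^sub>1" using assms by (intro mult_right_mono) auto
  \<comment> \<open>After \<open>d\<^sub>2\<close> and \<open>m\<close> cancel, the cut inequality
    would make this product at most -1.\<close>
  moreover have "0 \<le> (\<beta> - d\<^sub>1) * (b - d\<^sub>1 - 1)" using assms by simp
  ultimately show False
    using cut \<sigma> by (simp add: algebra_simps)
qed

section \<open>Counting edges at vertices\<close>

text \<open>Since \<open>x\<close> is outside \<open>W\<close>, an edge at \<open>x\<close> meeting
  \<open>W\<close> is determined by its other end, so there are at most \<open>card W\<close> of
  them.\<close>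

lemma degree_le_card_plus_avoiding:
  assumes graph: "simple_graph V E" and "finite W" "x \<notin> W"
  shows "degree E x \<le> card W + degree {e \<in> E. e \<inter> W = {}} x"
proof -
  have meet: "{e \<in> E. x \<in> e \<and> e \<inter> W \<noteq> {}} \<subseteq> (\<lambda>w. {x, w}) ` W"
  proof
    fix e assume "e \<in> {e \<in> E. x \<in> e \<and> e \<inter> W \<noteq> {}}"
    then obtain w where e: "e \<in> E" "x \<in> e" "w \<in> e" "w \<in> W" by blast
    then have "e = {x, w}"
      using graph \<open>x \<notin> W\<close> by (auto simp: simple_graph_def card_2_iff)
    with e show "e \<in> (\<lambda>w. {x, w}) ` W" by blast
  qed
  have "incident_edges E x = {e \<in> E. x \<in> e \<and> e \<inter> W \<noteq> {}} \<union> incident_edges {e \<in> E. e \<inter> W = {}} x"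
    by (auto simp: incident_edges_def)
  then have "degree E x \<le> card {e \<in> E. x \<in> e \<and> e \<inter> W \<noteq> {}} + degree {e \<in> E. e \<inter> W = {}} x"
    by (simp add: degree_def card_Un_le)
  also have "card {e \<in> E. x \<in> e \<and> e \<inter> W \<noteq> {}} \<le> card W"
    using \<open>finite W\<close> meet by (meson card_image_le card_mono finite_imageI le_trans)
  finally show ?thesis by simp
qed

lemma card_neighbours_le_degree:
  assumes "finite E"
  shows "card {z \<in> T. {x, z} \<in> E} \<le> degree E x"
  unfolding degree_def
proof (rule card_inj_on_le[of "\<lambda>z. {x, z}"])
  show "inj_on (\<lambda>z. {x, z}) {z \<in> T. {x, z} \<in> E}" by (auto simp: inj_on_def doubleton_eq_iff)
qed (use assms in \<open>auto simp: incident_edges_def\<close>)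

lemma sum_degree_le_twice_card:
  assumes "finite T" "finite H" "\<And>e. e \<in> H \<Longrightarrow> card e = 2"
  shows "(\<Sum>x\<in>T. degree H x) \<le> 2 * card H"
proof -
  have "(\<Sum>x\<in>T. degree H x) = (\<Sum>e\<in>H. card (e \<inter> T))"
    using sum_degree_swap[OF assms(1,2), of "\<lambda>_. 1 :: nat"] by (simp add: degree_def)
  also have "\<dots> \<le> (\<Sum>e\<in>H. 2)"
  proof (rule sum_mono)
    fix e assume "e \<in> H"
    then have "card e = 2" by (rule assms(3))
    then have "finite e" by (auto intro: card_ge_0_finite)
    then show "card (e \<inter> T) \<le> 2" using card_mono[of e "e \<inter> T"] \<open>card e = 2\<close> by simp
  qed
  finally show ?thesis by simp
qed

section \<open>From a violated cut to the numerical contradictions\<close>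

theorem theorem5:
  fixes V :: "'a set" and E :: "'a set set"
    and n a b m \<Delta> :: nat
    and g f :: "'a \<Rightarrow> int"
  assumes "simple_graph V E"
    and "card V = n"
    and "int b - int \<Delta> \<ge> int a" and "a \<ge> 2"
    and "real (min_degree V E) \<ge>
           (real \<Delta> + real a) * real n / (real b + 2 * real a + real \<Delta>)
           + real b * (real b - real \<Delta>) / (real \<Delta> + real a) + real m"
    and "real n >
           (real b + real a + 2 * real m - 1) * (real b + 2 * real a + real \<Delta>)
           / (real \<Delta> + real a)"
    and "\<And>x. x \<in> V \<Longrightarrow>
           int b - int \<Delta> \<ge> f x - int \<Delta> \<and> f x - int \<Delta> \<ge> g x \<and> g x \<ge> int a"
    and "\<And>x y. x \<in> V \<Longrightarrow> y \<in> V \<Longrightarrow> x \<noteq> y \<Longrightarrow> {x, y} \<notin> E \<Longrightarrow>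
           real (max (degree E y) (degree E x)) \<ge>
             (real b + real a) * real n / (real b + 2 * real a + real \<Delta>)"
  shows "fractional_ID_deleted V E g f m"
proof -
  define A c \<beta> N :: real where "A = real a + real b" and "c = real \<Delta> + real a"
    and "\<beta> = real b - real \<Delta>" and "N = real n / (real b + 2 * real a + real \<Delta>)"
  note graph = assms(1) and gf = assms(7)
  have finV: "finite V" and edge: "\<And>e. e \<in> E \<Longrightarrow> e \<subseteq> V \<and> card e = 2"
    using graph by (auto simp: simple_graph_def)
  have finE: "finite E" by (rule finite_edges[OF graph])
  have A: "A = c + \<beta>" by (simp add: A_def c_def \<beta>_def)
  have c2: "2 \<le> c" and \<beta>2: "2 \<le> \<beta>" and cb: "c \<le> real b" and \<beta>b: "\<beta> \<le> real b"
    using assms(3,4) by (simp_all add: c_def \<beta>_def)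
  have n: "real n = (A + c) * N"
  proof -
    have "A + c = real b + 2 * real a + real \<Delta>" by (simp add: A_def c_def)
    moreover have "0 < A + c" using assms(4) by (simp add: A_def c_def)
    ultimately show ?thesis by (simp add: N_def)
  qed
  have N: "A + 2 * real m - 1 < c * N"
  proof -
    have k: "0 < real b + 2 * real a + real \<Delta>" using assms(4) by simp
    have "(A + 2 * real m - 1) * (real b + 2 * real a + real \<Delta>) / c < real n"
      using assms(6) by (simp add: A_def c_def add.commute add.left_commute)
    then have "(A + 2 * real m - 1) * (real b + 2 * real a + real \<Delta>) < c * real n"
      using c2 by (simp add: pos_divide_less_eq mult.commute)
    then show ?thesis using k by (simp add: N_def pos_less_divide_eq)
  qed
  have min_deg: "c * N + real b * \<beta> / c + real m \<le> real (degree E x)" if "x \<in> V" for x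
  proof -
    have "min_degree V E \<le> degree E x"
      unfolding min_degree_def using finV that by simp
    then show ?thesis using assms(5) by (simp add: c_def \<beta>_def N_def)
  qed
  have ore: "A * N \<le> real (max (degree E y) (degree E x))"
    if "x \<in> V" "y \<in> V" "x \<noteq> y" "{x, y} \<notin> E" for x y
    using assms(8)[OF that] by (simp add: A_def N_def add.commute)
  have "\<exists>h. fractional_factor (V - I) ({e \<in> E. e \<inter> I = {}} - H) g f h"
    if I: "independent_set V E I" and H: "H \<subseteq> {e \<in> E. e \<inter> I = {}}" "card H = m" for I H
  proof (rule ccontr)
    assume no_factor: "\<not> ?thesis"
    define F where "F = {e \<in> E. e \<inter> I = {}} - H"
    have "simple_graph (V - I) F"
      using graph by (auto simp: simple_graph_def F_def)
    then obtain S T where ST: "S \<subseteq> V - I" "T \<subseteq> V - I" "S \<inter> T = {}"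
      and cut: "sum f S + (\<Sum>x\<in>T. int (degree {e\<in>F. e \<inter> S = {}} x)) < sum g T"
      and low: "\<And>x. x \<in> T \<Longrightarrow> int (degree {e\<in>F. e \<inter> S = {}} x) < g x"
    proof (rule fractional_factor_obstruction)
      show "g x \<le> f x" if "x \<in> V - I" for x using gf[of x] that by auto
    qed (use no_factor in \<open>auto simp: F_def\<close>)
    have IV: "I \<subseteq> V" using I by (simp add: independent_set_def)
    have fin: "finite I" "finite S" "finite T" "finite H"
      using finV finE IV ST H by (auto intro: finite_subset)
    \<comment> \<open>\<open>D\<close> is the degree in G - I - S and \<open>D'\<close> the degree
      once \<open>H\<close> is removed as well.\<close>
    define D where "D x = degree {e \<in> E. e \<inter> (I \<union> S) = {}} x" for x
    define D' where "D' x = degree {e \<in> F. e \<inter> S = {}} x" for x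
    define i \<sigma> \<tau> where "i = real (card I)" and "\<sigma> = real (card S)" and "\<tau> = real (card T)"
    have deg_D: "real (degree E x) \<le> i + \<sigma> + real (D x)" if "x \<in> T" for x
    proof -
      have "x \<notin> I \<union> S" using that ST by blast
      then have "degree E x \<le> card (I \<union> S) + D x"
        unfolding D_def using fin by (intro degree_le_card_plus_avoiding[OF graph]) auto
      moreover have "card (I \<union> S) \<le> card I + card S" by (rule card_Un_le)
      ultimately show ?thesis unfolding i_def \<sigma>_def by linarith
    qed
    have D_D': "D x \<le> D' x + degree H x" for x
    proof -
      have "incident_edges {e \<in> E. e \<inter> (I \<union> S) = {}} x
          \<subseteq> incident_edges {e \<in> F. e \<inter> S = {}} x \<union> incident_edges H x"
        by (auto simp: incident_edges_def F_def)
      then have "D x \<le> card (incident_edges {e \<in> F. e \<inter> S = {}} x \<union> incident_edges H x)"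
        unfolding D_def degree_def using finE fin(4)
        by (intro card_mono) (auto simp: incident_edges_def F_def)
      also have "\<dots> \<le> D' x + degree H x" unfolding D'_def degree_def by (rule card_Un_le)
      finally show ?thesis .
    qed
    have deg_H: "degree H x \<le> m" for x
      unfolding degree_def H(2)[symmetric] using fin(4)
      by (intro card_mono) (auto simp: incident_edges_def)
    have sum_deg_H: "(\<Sum>x\<in>T. degree H x) \<le> 2 * m"
      using sum_degree_le_twice_card[OF fin(3,4)] H edge by auto
    have D'_low: "real (D' x) + 1 \<le> \<beta>" if "x \<in> T" for x
    proof -
      have "int (D' x) < int b - int \<Delta>"
        using low[OF that] gf[of x] that ST unfolding D'_def by force
      then show ?thesis unfolding \<beta>_def by linarith
    qed
    \<comment> \<open>The bound -1 comes from the strict inequality between integers.\<close>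
    have cut': "c * \<sigma> + (\<Sum>x\<in>T. real (D' x)) - \<beta> * \<tau> \<le> - 1"
    proof -
      have "(\<Sum>x\<in>S. int \<Delta> + int a) \<le> sum f S"
        using gf ST by (intro sum_mono) force
      moreover have "sum g T \<le> (\<Sum>x\<in>T. int b - int \<Delta>)"
        using gf ST by (intro sum_mono) force
      ultimately have "int (card S) * (int \<Delta> + int a) + (\<Sum>x\<in>T. int (D' x))
          - int (card T) * (int b - int \<Delta>) \<le> - 1"
        using cut by (simp add: D'_def)
      then have "real_of_int (int (card S) * (int \<Delta> + int a) + (\<Sum>x\<in>T. int (D' x))
          - int (card T) * (int b - int \<Delta>)) \<le> - 1"
        by linarith
      then show ?thesis by (simp add: c_def \<beta>_def \<sigma>_def \<tau>_def mult.commute)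
    qed
    have cutD: "c * \<sigma> + (\<Sum>x\<in>T. real (D x)) - \<beta> * \<tau> \<le> 2 * real m - 1"
    proof -
      have "(\<Sum>x\<in>T. D x) \<le> (\<Sum>x\<in>T. D' x + degree H x)" by (intro sum_mono D_D')
      then have "(\<Sum>x\<in>T. D x) \<le> (\<Sum>x\<in>T. D' x) + 2 * m"
        using sum_deg_H by (simp add: sum.distrib)
      then have "real (\<Sum>x\<in>T. D x) \<le> real ((\<Sum>x\<in>T. D' x) + 2 * m)"
        by (simp only: of_nat_le_iff)
      then show ?thesis using cut' by simp
    qed
    \<comment> \<open>Of two vertices of \<open>I\<close>, one has degree at least
      \<open>A * N\<close>, and all its neighbours lie outside \<open>I\<close>; hence
      \<open>i\<close> is at most \<open>n - A * N = c * N\<close>. For fewer vertices,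
      \<open>c * N > 1\<close> suffices.\<close>
    have i: "i \<le> c * N"
    proof (cases "card I \<le> 1")
      case True
      then show ?thesis using N c2 \<beta>2 A unfolding i_def by linarith
    next
      case False
      then obtain x y where xy: "x \<in> I" "y \<in> I" "x \<noteq> y"
        using fin(1) by (metis card_le_Suc0_iff_eq One_nat_def)
      have "A * N \<le> real n - i" if "z \<in> I" "A * N \<le> real (degree E z)" for z
      proof -
        have "degree E z \<le> card (V - I) + degree {e \<in> E. e \<inter> (V - I) = {}} z"
          using finV that by (intro degree_le_card_plus_avoiding[OF graph]) auto
        moreover have "incident_edges {e \<in> E. e \<inter> (V - I) = {}} z = {}"
        proof -
          have False if e: "e \<in> E" "e \<inter> (V - I) = {}" for e
          proof -
            have "e \<subseteq> I" using edge[OF e(1)] e(2) by blast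
            moreover obtain u v where "e = {u, v}" using edge[OF e(1)] by (auto simp: card_2_iff)
            ultimately show False using I e(1) by (auto simp: independent_set_def)
          qed
          then show ?thesis by (auto simp: incident_edges_def)
        qed
        moreover have "real (card (V - I)) = real n - i"
          using card_mono[OF finV IV] fin(1) IV assms(2) by (simp add: card_Diff_subset i_def of_nat_diff)
        ultimately show ?thesis using that(2) by (simp add: degree_def)
      qed
      moreover have "A * N \<le> real (degree E x) \<or> A * N \<le> real (degree E y)"
      proof -
        have "x \<in> V" "y \<in> V" "{x, y} \<notin> E" using xy IV I by (auto simp: independent_set_def)
        then show ?thesis using ore[of x y] xy(3) by (auto simp: max_def split: if_splits)
      qed
      ultimately have "A * N \<le> real n - i" using xy by blast
      then show ?thesis by (simp add: n algebra_simps)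
    qed
    have total: "\<tau> \<le> (A + c) * N - \<sigma> - i"
    proof -
      have "card (I \<union> S \<union> T) = card I + card S + card T"
      proof -
        have "I \<inter> S = {}" "(I \<union> S) \<inter> T = {}" using ST by blast+
        then show ?thesis using fin by (simp add: card_Un_disjoint)
      qed
      moreover have "card (I \<union> S \<union> T) \<le> n"
        using ST IV finV assms(2) by (auto intro!: card_mono)
      ultimately show ?thesis unfolding n[symmetric] i_def \<sigma>_def \<tau>_def by linarith
    qed
    have \<sigma>_low: "real b * \<beta> + c * real m - c * real (D x) \<le> c * \<sigma>" if "x \<in> T" for x
    proof -
      have "real b * \<beta> / c + real m - real (D x) \<le> \<sigma>"
        using min_deg[of x] deg_D[OF that] i that ST by auto
      then have "c * (real b * \<beta> / c + real m - real (D x)) \<le> c * \<sigma>"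
        using c2 by (intro mult_left_mono) auto
      then show ?thesis using c2 by (simp add: algebra_simps)
    qed
    have "T \<noteq> {}"
    proof
      assume "T = {}"
      then have "c * \<sigma> \<le> - 1" using cut' by (simp add: \<tau>_def)
      moreover have "0 \<le> c * \<sigma>" using c2 by (simp add: \<sigma>_def)
      ultimately show False by linarith
    qed
    \<comment> \<open>At a single vertex \<open>H\<close> costs at most \<open>m\<close>, which the
      summand \<open>m\<close> in the minimum degree absorbs. So \<open>c * \<sigma>\<close> is at
      least \<open>b * (\<beta> - D' x0)\<close>, while the cut puts it below
      \<open>\<tau> * (\<beta> - D' x0)\<close>.\<close>
    have bT: "real b < \<tau>"
    proof -
      obtain x0 where x0: "x0 \<in> T" "\<And>x. x \<in> T \<Longrightarrow> D' x0 \<le> D' x"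
        using ex_min_if_finite[of "D' ` T"] fin(3) \<open>T \<noteq> {}\<close> by (force simp: not_less)
      have "real (D x0) \<le> real (D' x0) + real m" using D_D'[of x0] deg_H[of x0] by linarith
      then have "c * real (D x0) \<le> c * (real (D' x0) + real m)"
        using c2 by (intro mult_left_mono) auto
      moreover have "c * real (D' x0) \<le> real b * real (D' x0)"
        using cb by (intro mult_right_mono) auto
      moreover have "\<tau> * real (D' x0) \<le> (\<Sum>x\<in>T. real (D' x))"
        using sum_bounded_below[of T "real (D' x0)" "\<lambda>x. real (D' x)"] x0(2) by (simp add: \<tau>_def)
      ultimately have "real b * (\<beta> - real (D' x0)) < \<tau> * (\<beta> - real (D' x0))"
        using cut' \<sigma>_low[OF x0(1)] by (simp add: algebra_simps)
      then show ?thesis using D'_low[OF x0(1)] by (simp add: mult_less_cancel_right)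
    qed
    have cm: "2 * real m \<le> c * real m" using c2 by (intro mult_right_mono) auto
    obtain x1 where x1: "x1 \<in> T" "\<And>x. x \<in> T \<Longrightarrow> D x1 \<le> D x"
      using ex_min_if_finite[of "D ` T"] fin(3) \<open>T \<noteq> {}\<close> by (force simp: not_less)
    \<comment> \<open>\<open>D'_low\<close> bounds only \<open>D'\<close>, so \<open>D\<close> needs
      its own argument: if \<open>D x1\<close> were at least \<beta>, then \<open>\<tau> > c\<close>
      would let the sum of \<open>D\<close> over \<open>T\<close> outweigh the loss
      \<open>c * D x1\<close> in \<open>\<sigma>_low\<close>.\<close>
    have d1: "real (D x1) + 1 \<le> \<beta>"
    proof (rule ccontr)
      assume "\<not> ?thesis"
      then have "\<not> int (D x1) < int b - int \<Delta>" unfolding \<beta>_def by linarith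
      then have ge: "\<beta> \<le> real (D x1)" unfolding \<beta>_def by linarith
      have "\<tau> * real (D x1) \<le> (\<Sum>x\<in>T. real (D x))"
        using sum_bounded_below[of T "real (D x1)" "\<lambda>x. real (D x)"] x1(2) by (simp add: \<tau>_def)
      moreover have "0 \<le> (\<tau> - c) * (real (D x1) - \<beta>)" using ge bT cb by simp
      moreover have "c * \<beta> \<le> real b * \<beta>" using cb \<beta>2 by (intro mult_right_mono) auto
      ultimately show False
        using cutD \<sigma>_low[OF x1(1)] cm by (simp add: algebra_simps)
    qed
    \<comment> \<open>The closed neighbourhood of \<open>x1\<close> within \<open>T\<close>: it has
      at most \<open>D x1 + 1\<close> elements, fewer than \<open>T\<close>, and any vertex of
      \<open>T - P\<close> may be paired with \<open>x1\<close> in \<open>ore\<close>.\<close>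
    define P where "P = {z \<in> T. z = x1 \<or> {x1, z} \<in> E}"
    have P_card: "real (card P) \<le> real (D x1) + 1"
    proof -
      have "P = insert x1 {z \<in> T. {x1, z} \<in> {e \<in> E. e \<inter> (I \<union> S) = {}}}"
        using x1(1) ST by (auto simp: P_def)
      then have "card P \<le> Suc (card {z \<in> T. {x1, z} \<in> {e \<in> E. e \<inter> (I \<union> S) = {}}})"
        using fin(3) by (simp add: card_insert_if)
      moreover have "card {z \<in> T. {x1, z} \<in> {e \<in> E. e \<inter> (I \<union> S) = {}}} \<le> D x1"
        unfolding D_def using finE by (intro card_neighbours_le_degree) auto
      ultimately show ?thesis by linarith
    qed
    have PT: "P \<subseteq> T" by (auto simp: P_def)
    have "T - P \<noteq> {}"
    proof
      assume "T - P = {}"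
      then have "P = T" using PT by blast
      then show False using P_card d1 bT \<beta>b by (simp add: \<tau>_def)
    qed
    then obtain x2 where x2: "x2 \<in> T - P" "\<And>x. x \<in> T - P \<Longrightarrow> D x2 \<le> D x"
      using ex_min_if_finite[of "D ` (T - P)"] fin(3) by (force simp: not_less)
    have d12: "real (D x1) \<le> real (D x2)" using x1(2) x2(1) by simp
    \<comment> \<open>Whichever of \<open>x1\<close> and \<open>x2\<close> has the large degree in
      G, its value of \<open>D\<close> is at most \<open>D x2\<close>.\<close>
    have \<sigma>_ore: "A * N - i - real (D x2) \<le> \<sigma>"
    proof -
      have "A * N \<le> real (max (degree E x2) (degree E x1))"
        using x1(1) x2(1) ST by (intro ore) (auto simp: P_def)
      then show ?thesis
        using deg_D[OF x1(1)] deg_D[of x2] x2(1) d12 by (auto simp: max_def split: if_splits)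
    qed
    have sum_D: "\<tau> * real (D x2) - (real (D x2) - real (D x1)) * (real (D x1) + 1) \<le> (\<Sum>x\<in>T. real (D x))"
    proof -
      have "real (card P) * real (D x1) \<le> (\<Sum>x\<in>P. real (D x))"
        using sum_bounded_below[of P "real (D x1)" "\<lambda>x. real (D x)"] x1(2) PT by auto
      moreover have "real (card (T - P)) * real (D x2) \<le> (\<Sum>x\<in>T - P. real (D x))"
        using sum_bounded_below[of "T - P" "real (D x2)" "\<lambda>x. real (D x)"] x2(2) by auto
      moreover have "real (card (T - P)) = \<tau> - real (card P)"
        using PT fin(3) by (simp add: \<tau>_def card_Diff_subset finite_subset of_nat_diff card_mono)
      moreover have "(\<Sum>x\<in>T. real (D x)) = (\<Sum>x\<in>T - P. real (D x)) + (\<Sum>x\<in>P. real (D x))"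
        by (rule sum.subset_diff[OF PT fin(3)])
      moreover have "(real (D x2) - real (D x1)) * real (card P)
          \<le> (real (D x2) - real (D x1)) * (real (D x1) + 1)"
        using P_card d12 by (intro mult_left_mono) auto
      ultimately show ?thesis by (simp add: algebra_simps)
    qed
    have cut2: "c * \<sigma> - (\<beta> - real (D x2)) * \<tau> - (real (D x2) - real (D x1)) * (real (D x1) + 1) \<le> 2 * real m - 1"
      using cutD sum_D by (simp add: algebra_simps)
    consider "D x2 = 0" | "1 \<le> real (D x2)" "real (D x2) \<le> \<beta>" | "\<beta> \<le> real (D x2)"
      by (cases "D x2 = 0") force+
    then show False
    proof cases
      case 1
      \<comment> \<open>The cut for \<open>D'\<close> is taken here, since the one for
        \<open>D\<close> has the slack \<open>2 * m\<close>, which only the factor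
        \<open>d\<^sub>2\<close> of the bound on \<open>N\<close> could compensate.\<close>
      have "0 \<le> (\<Sum>x\<in>T. real (D' x))" by (simp add: sum_nonneg)
      then have "c * \<sigma> - \<beta> * \<tau> < 0" using cut' by linarith
      with 1 show False
        using no_cut_zero_degree[OF A _ _ i _ total] \<sigma>_ore \<beta>2 c2 by simp
    next
      case 2
      then show False
        using no_cut_small_degree[OF A _ 2 _ _ i N \<sigma>_ore total cut2] c2 by simp
    next
      case 3
      then show False
        using no_cut_large_degree[OF cb \<beta>b _ d1 3 bT _ cut2] \<sigma>_low[OF x1(1)] cm by simp
    qed
  qed
  then show ?thesis
    unfolding fractional_ID_deleted_def fractional_deleted_def by blast
qed

end
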